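(* Let $G$ be a finite group. If $G$ is of odd order, then the matching number is $\alpha'(\mathcal{P}_e(G)) = \dfrac{|G|-1}{2}$. If $G$ is of even order, then $$\frac{|G|-(t-1)}{2} \leq \alpha'(\mathcal{P}_e(G)) \leq \frac{|G|}{2},$$ where $t$ is the number of involutions in $G$.
   Context: The enhanced power graph $\mathcal{P}_e(G)$ of a group $G$ is the simple undirected graph with vertex set $G$ in which two distinct vertices are adjacent if and only if they belong to a common cyclic subgroup of $G$. An involution is an element of order $2$. The matching number $\alpha'(\Gamma)$ of a graph $\Gamma$ is the maximum cardinality of a matching, i.e. of a set of edges no two of which share an endpoint. *)

theory Defs
  imports "HOL-Algebra.Elementary_Groups" "HOL-Algebra.Multiplicative_Group"
begin

(* A simple undirected graph: the vertices, and the edges as two-element sets of vertices. *)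
record 'v sgraph =
  verts :: "'v set"
  edges :: "'v set set"

definition simple_graph :: "'v sgraph \<Rightarrow> bool" where
  "simple_graph \<Gamma> \<longleftrightarrow> (\<forall>e\<in>edges \<Gamma>. e \<subseteq> verts \<Gamma> \<and> card e = 2)"

definition matching :: "'v sgraph \<Rightarrow> 'v set set \<Rightarrow> bool" where
  "matching \<Gamma> M \<longleftrightarrow> M \<subseteq> edges \<Gamma> \<and> pairwise disjnt M"

(* Only meaningful when there are finitely many edges: Max is unspecified on infinite sets,
   and card is 0 on them. *)
definition matching_number :: "'v sgraph \<Rightarrow> nat" where
  "matching_number \<Gamma> = Max {card M | M. matching \<Gamma> M}"

definition enhanced_power_graph :: "('a, 'b) monoid_scheme \<Rightarrow> 'a sgraph" where
  "enhanced_power_graph G =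
    \<lparr> verts = carrier G,
      edges = {{x, y} | x y. x \<in> carrier G \<and> y \<in> carrier G \<and> x \<noteq> y \<and>
        (\<exists>C. subgroup C G \<and> cyclic_group (G\<lparr>carrier := C\<rparr>) \<and> x \<in> C \<and> y \<in> C)} \<rparr>"

definition involutions :: "('a, 'b) monoid_scheme \<Rightarrow> 'a set" where
  "involutions G = {x \<in> carrier G. group.ord G x = 2}"

lemma simple_graph_enhanced_power_graph: "simple_graph (enhanced_power_graph G)"
  by (auto simp: simple_graph_def enhanced_power_graph_def)

lemma finite_matching_cards:
  assumes "simple_graph \<Gamma>" "finite (verts \<Gamma>)"
  shows "finite {card M | M. matching \<Gamma> M}"
proof -
  have "{M. matching \<Gamma> M} \<subseteq> Pow (Pow (verts \<Gamma>))"
    using assms(1) by (auto simp: matching_def simple_graph_def)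
  hence "finite {M. matching \<Gamma> M}"
    using assms(2) by (meson finite_Pow_iff finite_subset)
  thus ?thesis by simp
qed

lemma matching_empty: "matching \<Gamma> {}"
  by (simp add: matching_def)

end

theory Submission
  imports Defs
begin

text \<open>
  Pairing each element with its inverse is a matching that misses exactly the identity and the
  involutions. By parity, a group of even order has an involution, so one further edge joins the
  identity to it; a group of odd order has none. The upper bounds hold for matchings in any graph.
\<close>

text \<open>Edges of a matching are disjoint two-element sets, so the cardinalities add up. If
  \<open>M\<close> is infinite, so is its union, and both sides are 0 by convention.\<close>

lemma card_Union_matching:
  assumes "simple_graph \<Gamma>" "matching \<Gamma> M"
  shows "card (\<Union>M) = 2 * card M"
proof -
  have 2: "card e = 2" if "e \<in> M" for e
    using assms that by (auto simp: simple_graph_def matching_def)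
  then have "card (\<Union>M) = (\<Sum>e\<in>M. card e)"
    using assms(2) by (intro card_Union_disjoint)
      (auto simp: matching_def pairwise_def disjnt_def intro: card_ge_0_finite)
  also have "\<dots> = 2 * card M"
    using 2 by simp
  finally show ?thesis .
qed

lemma matching_card_le:
  assumes "simple_graph \<Gamma>" "finite (verts \<Gamma>)" "matching \<Gamma> M"
  shows "2 * card M \<le> card (verts \<Gamma>)"
proof -
  have "\<Union>M \<subseteq> verts \<Gamma>"
    using assms(1,3) by (auto simp: simple_graph_def matching_def)
  then show ?thesis
    using card_mono[OF assms(2)] card_Union_matching[OF assms(1,3)] by metis
qed

lemma matching_number_upper:
  assumes "simple_graph \<Gamma>" "finite (verts \<Gamma>)"
  shows "2 * matching_number \<Gamma> \<le> card (verts \<Gamma>)"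
proof -
  \<comment> \<open>The empty matching makes this finite set nonempty, so the maximum is attained by
    an actual matching.\<close>
  have "matching_number \<Gamma> \<in> {card M | M. matching \<Gamma> M}"
    unfolding matching_number_def
    using finite_matching_cards[OF assms] matching_empty[of \<Gamma>] by (intro Max_in) auto
  then show ?thesis
    using matching_card_le[OF assms] by auto
qed

lemma card_matching_le_matching_number:
  assumes "simple_graph \<Gamma>" "finite (verts \<Gamma>)" "matching \<Gamma> M"
  shows "card M \<le> matching_number \<Gamma>"
  unfolding matching_number_def
  using finite_matching_cards[OF assms(1,2)] assms(3) by (intro Max_ge) auto

text \<open>The subgroup generated by \<open>x\<close> is itself a common cyclic subgroup. Every
  edge used for the lower bounds arises this way.\<close>

lemma (in group) edge_if_mem_generate:
  assumes "x \<in> carrier G" "y \<in> generate G {x}" "x \<noteq> y"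
  shows "{x, y} \<in> edges (enhanced_power_graph G)"
proof -
  have "subgroup (generate G {x}) G"
    using assms(1) by (simp add: generate_is_subgroup)
  moreover have "cyclic_group (G\<lparr>carrier := generate G {x}\<rparr>)"
    using cyclic_group_generated[of x] assms(1) by (simp add: subgroup_generated_def)
  moreover have "x \<in> generate G {x}"
    by (simp add: generate.incl)
  ultimately show ?thesis
    using assms subgroup.mem_carrier by (fastforce simp: enhanced_power_graph_def)
qed

lemma (in group) involutions_eq: "involutions G = {x \<in> carrier G. inv x = x} - {\<one>}"
proof -
  have "ord x = 2 \<longleftrightarrow> inv x = x \<and> x \<noteq> \<one>" if x: "x \<in> carrier G" for x
  proof -
    have sq: "x [^] (2::nat) = \<one> \<longleftrightarrow> inv x = x"
      using x by (metis Suc_1 inv_equality nat_pow_Suc nat_pow_eone r_inv)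
    \<comment> \<open>Primality of 2, to be applied with \<open>n\<close> the order of
      \<open>x\<close>: the square of \<open>x\<close> is trivial iff \<open>ord x\<close> divides
      2, and \<open>x\<close> is the identity iff \<open>ord x\<close> is 1.\<close>
    have "n dvd 2 \<and> n \<noteq> 1 \<longleftrightarrow> n = 2" for n :: nat
      by (metis Suc_1 Suc_lessI dvd_nat_bounds dvd_refl gr0_conv_Suc nat_dvd_not_less
          numeral_eq_one_iff semiring_norm(85) zero_less_numeral One_nat_def)
    then show ?thesis
      using sq pow_eq_id[OF x, of 2] ord_eq_1[OF x] by metis
  qed
  then show ?thesis
    by (auto simp: involutions_def)
qed

text \<open>The pairs are the two-element orbits of inversion, hence equal or disjoint, and each is
  an edge because \<open>inv x\<close> lies in the subgroup generated by \<open>x\<close>.\<close>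

lemma (in group) inverse_pairs_matching:
  defines "S \<equiv> {x \<in> carrier G. inv x \<noteq> x}"
  defines "M \<equiv> (\<lambda>x. {x, inv x}) ` S"
  shows "matching (enhanced_power_graph G) M" "\<Union>M = S"
proof -
  have "{x, inv x} \<in> edges (enhanced_power_graph G)" if "x \<in> S" for x
    using that by (intro edge_if_mem_generate) (auto simp: S_def intro: generate.inv)
  moreover have "disjnt {x, inv x} {y, inv y}"
    if "x \<in> S" "y \<in> S" "{x, inv x} \<noteq> {y, inv y}" for x y
    using that by (auto simp: S_def disjnt_def)
  ultimately show "matching (enhanced_power_graph G) M"
    unfolding matching_def M_def pairwise_def by blast
  show "\<Union>M = S"
    by (auto simp: M_def S_def)
qed

text \<open>The self-inverse elements are the involutions and the identity; the latter accounts for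
  the final 1.\<close>

lemma (in group) order_eq_involutions:
  assumes "finite (carrier G)"
  shows "order G = card {x \<in> carrier G. inv x \<noteq> x} + card (involutions G) + 1"
proof -
  let ?S = "{x \<in> carrier G. inv x \<noteq> x}"
  have "carrier G = ?S \<union> insert \<one> (involutions G)"
    by (auto simp: involutions_eq)
  moreover have "?S \<inter> insert \<one> (involutions G) = {}" "\<one> \<notin> involutions G"
    by (auto simp: involutions_eq)
  moreover have "finite ?S" "finite (involutions G)"
    using assms by (auto simp: involutions_eq)
  ultimately show ?thesis
    unfolding order_def
    by (metis (no_types, lifting) card_Un_disjoint card_insert_disjoint finite_insert add_Suc_right Suc_eq_plus1)
qed

theorem theorem3p5:
  fixes G :: "('a, 'b) monoid_scheme"
  assumes "group G" and "finite (carrier G)"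
  shows "(odd (order G) \<longrightarrow>
            real (matching_number (enhanced_power_graph G)) = (real (order G) - 1) / 2) \<and>
         (even (order G) \<longrightarrow>
            (real (order G) - (real (card (involutions G)) - 1)) / 2
              \<le> real (matching_number (enhanced_power_graph G)) \<and>
            real (matching_number (enhanced_power_graph G)) \<le> real (order G) / 2)"
proof -
  interpret group G by fact
  let ?\<Gamma> = "enhanced_power_graph G"
  let ?S = "{x \<in> carrier G. inv\<^bsub>G\<^esub> x \<noteq> x}"
  let ?M = "(\<lambda>x. {x, inv\<^bsub>G\<^esub> x}) ` ?S"
  have simple: "simple_graph ?\<Gamma>"
    by (rule simple_graph_enhanced_power_graph)
  have fin: "finite (verts ?\<Gamma>)"
    using assms(2) by (simp add: enhanced_power_graph_def)
  have upper: "2 * matching_number ?\<Gamma> \<le> order G"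
    using matching_number_upper[OF simple fin] by (simp add: enhanced_power_graph_def order_def)
  have cardM: "card ?S = 2 * card ?M"
    using card_Union_matching[OF simple inverse_pairs_matching(1)]
    by (simp add: inverse_pairs_matching(2))
  have lower: "card ?M \<le> matching_number ?\<Gamma>"
    by (rule card_matching_le_matching_number[OF simple fin inverse_pairs_matching(1)])
  \<comment> \<open>Both cases rest on this count: the group order and the number of involutions
    have opposite parity.\<close>
  have ord: "order G = 2 * card ?M + card (involutions G) + 1"
    using order_eq_involutions[OF assms(2)] cardM by simp
  show ?thesis
  proof (intro conjI impI)
    assume odd: "odd (order G)"
    \<comment> \<open>By Lagrange, an element of order 2 would make the group order even.\<close>
    have "x \<notin> involutions G" for x
      using odd ord_dvd_group_order[of x] by (auto simp: involutions_def)
    then have "involutions G = {}"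
      by blast
    \<comment> \<open>Now \<open>?M\<close> has (|G| - 1)/2 edges, and oddness sharpens
      \<open>upper\<close> by one to the same value.\<close>
    then show "real (matching_number ?\<Gamma>) = (real (order G) - 1) / 2"
      using odd upper lower ord by auto
  next
    assume "even (order G)"
    then have "odd (card (involutions G))"
      using ord by simp
    then have "involutions G \<noteq> {}"
      by (rule odd_card_imp_not_empty)
    then obtain z where z: "z \<in> involutions G"
      by blast
    then have z': "z \<in> carrier G" "inv\<^bsub>G\<^esub> z = z" "z \<noteq> \<one>\<^bsub>G\<^esub>"
      by (auto simp: involutions_eq)
    have "{z, \<one>\<^bsub>G\<^esub>} \<in> edges ?\<Gamma>"
      using z' by (intro edge_if_mem_generate) (auto intro: generate.one)
    \<comment> \<open>Both endpoints are self-inverse, so neither is covered by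
      \<open>?M\<close>.\<close>
    moreover have disj: "disjnt {z, \<one>\<^bsub>G\<^esub>} e" if "e \<in> ?M" for e
      using that z' inverse_pairs_matching(2) by (fastforce simp: disjnt_def)
    ultimately have match: "matching ?\<Gamma> (insert {z, \<one>\<^bsub>G\<^esub>} ?M)"
      using inverse_pairs_matching(1) disjnt_sym
      unfolding matching_def pairwise_insert by blast
    \<comment> \<open>Otherwise this nonempty edge would be disjoint from itself; hence the
      insertion really adds one edge.\<close>
    have "{z, \<one>\<^bsub>G\<^esub>} \<notin> ?M"
      using disj[of "{z, \<one>\<^bsub>G\<^esub>}"] by (auto simp only: disjnt_insert1)
    then have "card ?M + 1 \<le> matching_number ?\<Gamma>"
      using card_matching_le_matching_number[OF simple fin match] assms(2) by simp
    \<comment> \<open>With t involutions, \<open>ord\<close> gives 2(|\<open>?M\<close>| + 1) = |G|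
      - t - 1 + 2 = |G| - (t - 1).\<close>
    then show "(real (order G) - (real (card (involutions G)) - 1)) / 2 \<le> real (matching_number ?\<Gamma>)"
      using ord by simp
  next
    show "real (matching_number ?\<Gamma>) \<le> real (order G) / 2"
      using upper by simp
  qed
qed

end
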